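(* Let $f$ be a meromorphic function in $\mathbb{C}$, and suppose there are three distinct points $a_1,a_2,a_3$ of the Riemann sphere $\overline{\mathbb{C}}$ such that every solution $z\in\mathbb{C}$ of $f(z)=a_j$, $j=1,2,3$, is real. Then $f$ maps the real line into a circle of the Riemann sphere, unless $$f(z)=L\left(\frac{1-e^{i(c_1z-b_1)}}{1-e^{i(c_2z-b_2)}}\right),$$ where $L$ is a fractional-linear (Möbius) transformation and $c_1,c_2,b_1,b_2$ are real numbers.
   Context: A circle in the Riemann sphere means either a Euclidean circle in $\mathbb{C}$ or a straight line together with $\infty$. The value of $f$ at a pole is $\infty$. *)

theory Defs
  imports "HOL-Complex_Analysis.Complex_Analysis"
begin

text \<open>The Riemann sphere is modelled as \<open>complex option\<close>: \<open>Some w\<close> is the finite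
  point \<open>w\<close> and \<open>None\<close> is the point at infinity.\<close>

text \<open>Value of a meromorphic function (given by a representative \<open>f\<close>) on the Riemann
  sphere: at a pole it is infinity, elsewhere it is the limit value (so removable
  singularities of the representative are ignored).\<close>
definition sphere_val :: "(complex \<Rightarrow> complex) \<Rightarrow> complex \<Rightarrow> complex option" where
  "sphere_val f z = (if is_pole f z then None else Some (remove_sings f z))"

definition riemann_circle :: "complex option set \<Rightarrow> bool" where
  "riemann_circle C \<longleftrightarrow>
     (\<exists>c r. r > 0 \<and> C = Some ` sphere c r) \<or>
     (\<exists>p v. v \<noteq> 0 \<and> C = insert None (Some ` {p + of_real t * v | t. True}))"

definition moebius :: "complex \<Rightarrow> complex \<Rightarrow> complex \<Rightarrow> complex \<Rightarrow> complex option \<Rightarrow> complex option" where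
  "moebius a b c d w = (case w of
      None \<Rightarrow> (if c = 0 then None else Some (a / c))
    | Some u \<Rightarrow> (if c * u + d = 0 then None else Some ((a * u + b) / (c * u + d))))"

end

theory Submission
  imports Defs
begin

text \<open>
  Write \<open>f = g / h\<close> with entire \<open>g\<close>, \<open>h\<close> without common zeros. The solutions of \<open>f = a\<^sub>j\<close>
  are the zeros of a linear combination \<open>E\<^sub>j\<close> of \<open>g\<close> and \<open>h\<close>, scaled so that \<open>E\<^sub>1 - E\<^sub>3 = E\<^sub>2\<close>. As these
  zeros are real, \<open>E\<^sub>j\<close> and its reflection \<open>E\<^sub>j*(z) = cnj (E\<^sub>j (cnj z))\<close> have the same zeros with
  multiplicity, so \<open>E\<^sub>j = exp(u\<^sub>j) E\<^sub>j*\<close> with entire \<open>u\<^sub>j\<close>, and eliminating the reflections from the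
  two linear relations gives
  \<open>E\<^sub>1 (1 - exp(u\<^sub>2 - u\<^sub>1)) = E\<^sub>3 (1 - exp(u\<^sub>2 - u\<^sub>3))\<close>.
  If \<open>exp(u\<^sub>2 - u\<^sub>1)\<close> is identically 1, then \<open>E\<^sub>1 / E\<^sub>3\<close> is real on the real line; otherwise \<open>E\<^sub>1 / E\<^sub>3\<close>
  is the required quotient \<open>(1 - exp(u\<^sub>2 - u\<^sub>3)) / (1 - exp(u\<^sub>2 - u\<^sub>1))\<close>, once the exponents \<open>u\<^sub>2 - u\<^sub>k\<close> are known to be affine.

  In the upper half-plane \<open>E\<^sub>2 / E\<^sub>k\<close> and its reflection are holomorphic, without zeros, and
  omit 1 or -1. A sharp form of Schottky's theorem bounds the logarithm of the modulus of such a function by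
  \<open>A (1 + |z|\<^sup>2) / Im z\<close>, and the difference of the two logarithms is \<open>Re (u\<^sub>2 - u\<^sub>k)\<close>, which vanishes
  on the real line. Such a bound forces the Taylor coefficients of order at least 2 to vanish.
\<close>

section \<open>Sharp growth of functions omitting two values\<close>

text \<open>Puts the densities \<open>R^2 - (cmod z)^2\<close> at two points into the modulus of a
  function holomorphic in \<open>z\<close>, up to an error of second order at \<open>z = w\<close>.
  The next identity does the same for the density \<open>Re k\<close> of the right
  half-plane.\<close>

lemma cmod_disc_polarize:
  fixes z w :: complex and R :: real
  shows "(cmod (of_real (R^2) - cnj w * z))^2 = (R^2 - (cmod z)^2) * (R^2 - (cmod w)^2) + R^2 * (cmod (z - w))^2"
  unfolding cmod_power2 by (simp add: algebra_simps power2_eq_square)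

lemma cmod_halfplane_polarize:
  fixes k w :: complex
  shows "(cmod (k + cnj w))^2 = 4 * Re k * Re w + (cmod (k - w))^2"
  unfolding cmod_power2 by (simp add: algebra_simps power2_eq_square)

text \<open>
  The local step of Ahlfors' lemma: \<open>k\<close> maps to the right half-plane, and the ratio of the two
  hyperbolic metrics is compared through the polarizations \<open>D\<close> and \<open>S\<close> of their densities. The
  resulting \<open>\<Psi>\<close> is holomorphic, so the maximum modulus principle replaces the usual computation
  with the Laplacian.
\<close>
lemma hyperbolic_ratio_local_max_le:
  fixes k :: "complex \<Rightarrow> complex" and R e :: real
  assumes e: "e > 0" and sub: "ball z0 e \<subseteq> ball 0 R"
    and hol: "k holomorphic_on ball z0 e"
    and pos: "\<And>z. z \<in> ball z0 e \<Longrightarrow> Re (k z) > 0"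
    and max: "\<And>z. z \<in> ball z0 e \<Longrightarrow>
       cmod (deriv k z) * (R^2 - (cmod z)^2) / Re (k z) \<le> cmod (deriv k z0) * (R^2 - (cmod z0)^2) / Re (k z0)"
  shows "cmod (deriv k z0) * (R^2 - (cmod z0)^2) / Re (k z0) \<le> 2 * R"
proof (rule ccontr)
  assume "\<not> ?thesis"
  hence big: "2 * R < cmod (deriv k z0) * (R^2 - (cmod z0)^2) / Re (k z0)" by simp
  define D where "D z = of_real (R^2) - cnj z0 * z" for z
  define S where "S z = k z + cnj (k z0)" for z
  define \<Psi> where "\<Psi> z = deriv k z * (D z)^2 / (S z)^2" for z
  have z0: "z0 \<in> ball z0 e" using e by simp
  have k0: "Re (k z0) > 0" using pos[OF z0] .
  have inR: "(cmod z)^2 < R^2" "R > 0" if "z \<in> ball z0 e" for z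
  proof -
    have "cmod z < R" using that sub by auto
    thus "(cmod z)^2 < R^2" "R > 0"
      by (smt (verit) norm_ge_zero power_strict_mono zero_less_numeral, smt (verit) norm_ge_zero)
  qed
  have D2: "(cmod (D z))^2 = (R^2 - (cmod z)^2) * (R^2 - (cmod z0)^2) + R^2 * (cmod (z - z0))^2" for z
    unfolding D_def by (rule cmod_disc_polarize)
  have S2: "(cmod (S z))^2 = 4 * Re (k z) * Re (k z0) + (cmod (k z - k z0))^2" for z
    unfolding S_def by (rule cmod_halfplane_polarize)
  have Dpos: "cmod (D z) > 0" if "z \<in> ball z0 e" for z
  proof -
    have "(R^2 - (cmod z)^2) * (R^2 - (cmod z0)^2) > 0" using inR[OF that] inR[OF z0] by simp
    hence "(cmod (D z))^2 > 0" unfolding D2 by (smt (verit) mult_nonneg_nonneg zero_le_power2)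
    thus ?thesis by auto
  qed
  have Spos: "cmod (S z) > 0" if "z \<in> ball z0 e" for z
  proof -
    have "Re (S z) > 0" unfolding S_def using pos[OF that] k0 by simp
    thus ?thesis by (metis zero_complex.simps(1) zero_less_norm_iff less_irrefl)
  qed
  have D0: "D z0 = of_real (R^2 - (cmod z0)^2)"
    unfolding D_def by (simp add: complex_norm_square[symmetric] mult.commute[of "cnj z0"])
  have S0: "S z0 = of_real (2 * Re (k z0))" unfolding S_def by (simp add: complex_add_cnj)
  have hol\<Psi>: "\<Psi> holomorphic_on ball z0 e"
    unfolding \<Psi>_def D_def S_def
    by (intro holomorphic_intros hol holomorphic_deriv) (use Spos S_def in auto)
  have k': "(k has_field_derivative deriv k z0) (at z0)"
    using hol z0 by (simp add: holomorphic_derivI)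
  have "(k \<longlongrightarrow> k z0) (at z0)" using DERIV_isCont[OF k'] by (simp add: isCont_def)
  hence Slim: "((\<lambda>z. S z) \<longlongrightarrow> S z0) (at z0)" unfolding S_def by (intro tendsto_intros)
  have Dlim: "((\<lambda>z. D z) \<longlongrightarrow> D z0) (at z0)" unfolding D_def by (intro tendsto_intros)
  \<comment> \<open>By \<open>big\<close> the infinitesimal Schwarz-Pick inequality fails at
    \<open>z0\<close>; by continuity its finite form fails at all nearby \<open>z\<close>.\<close>
  have "((\<lambda>z. cmod ((k z - k z0) / (z - z0)) * cmod (D z) / cmod (S z)) \<longlongrightarrow>
      cmod (deriv k z0) * cmod (D z0) / cmod (S z0)) (at z0)"
    by (intro tendsto_intros Slim Dlim) (use k' Spos[OF z0] in \<open>auto simp: has_field_derivative_iff\<close>)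
  moreover have "R < cmod (deriv k z0) * cmod (D z0) / cmod (S z0)"
  proof -
    have "cmod (D z0) = R^2 - (cmod z0)^2" "cmod (S z0) = 2 * Re (k z0)"
      unfolding D0 S0 norm_of_real using inR[OF z0] k0 by auto
    moreover have "R < cmod (deriv k z0) * (R^2 - (cmod z0)^2) / (2 * Re (k z0))"
      using big k0 by (simp add: field_simps)
    ultimately show ?thesis by simp
  qed
  ultimately have "\<forall>\<^sub>F z in at z0. R < cmod ((k z - k z0) / (z - z0)) * cmod (D z) / cmod (S z)"
    by (rule order_tendstoD)
  then obtain d where d: "d > 0"
    and dR: "\<And>z. z \<noteq> z0 \<Longrightarrow> dist z z0 < d \<Longrightarrow> R < cmod ((k z - k z0) / (z - z0)) * cmod (D z) / cmod (S z)"
    unfolding eventually_at by blast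
  define r where "r = min d e"
  have r: "r > 0" "r \<le> d" "r \<le> e" using d e by (auto simp: r_def)
  have less: "cmod (\<Psi> z) < cmod (\<Psi> z0)" if z: "z \<in> ball z0 r" "z \<noteq> z0" for z
  proof -
    have ze: "z \<in> ball z0 e" using z r by auto
    note Dz = Dpos[OF ze] and Sz = Spos[OF ze]
    have kz: "Re (k z) > 0" using pos[OF ze] .
    have "R < cmod (k z - k z0) / cmod (z - z0) * cmod (D z) / cmod (S z)"
      using dR[of z] z r by (auto simp: norm_divide dist_commute)
    hence "R * cmod (z - z0) * cmod (S z) < cmod (k z - k z0) * cmod (D z)"
      using Sz z by (simp add: field_simps)
    hence lt: "(R * cmod (z - z0) * cmod (S z))^2 < (cmod (k z - k z0) * cmod (D z))^2"
      using inR[OF ze] by (intro power_strict_mono) auto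
    \<comment> \<open>By the polarizations, \<open>s - X\<close> and \<open>t - Y\<close> are
      products of the densities at \<open>z\<close> and \<open>z0\<close> (the former times 4).
      Maximality compares the values of \<open>\<Psi>\<close> through \<open>s * (t - Y)\<close> and
      \<open>t * (s - X)\<close>; \<open>lt'\<close> decides which is larger and makes
      \<open>z0\<close> a strict maximum.\<close>
    define s t X Y where "s = (cmod (S z))^2" and "t = (cmod (D z))^2"
      and "X = (cmod (k z - k z0))^2" and "Y = R^2 * (cmod (z - z0))^2"
    have lt': "s * Y < X * t" using lt unfolding s_def t_def X_def Y_def
      by (simp add: power_mult_distrib mult_ac)
    have q: "cmod (\<Psi> z) * (s * (R^2 - (cmod z)^2)) / (t * Re (k z)) \<le> cmod (\<Psi> z0) * (4 * Re (k z0)) / (R^2 - (cmod z0)^2)"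
    proof -
      have "cmod z0 \<noteq> R" "R \<noteq> cmod z0" using inR[OF z0] by auto
      have "cmod (deriv k z) = cmod (\<Psi> z) * s / t"
        unfolding \<Psi>_def s_def t_def using Dz Sz by (simp add: norm_mult norm_divide norm_power)
      moreover have "cmod (deriv k z0) = cmod (\<Psi> z0) * (2 * Re (k z0))^2 / (R^2 - (cmod z0)^2)^2"
        unfolding \<Psi>_def D0 S0 norm_mult norm_divide norm_power norm_of_real
        using k0 \<open>cmod z0 \<noteq> R\<close> \<open>R \<noteq> cmod z0\<close> inR[OF z0] by simp
      ultimately have "cmod (\<Psi> z) * s / t * (R^2 - (cmod z)^2) / Re (k z)
        \<le> cmod (\<Psi> z0) * (2 * Re (k z0))^2 / (R^2 - (cmod z0)^2)^2 * (R^2 - (cmod z0)^2) / Re (k z0)"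
        using max[OF ze] by simp
      also have "\<dots> = cmod (\<Psi> z0) * (4 * Re (k z0)) / (R^2 - (cmod z0)^2)"
      proof -
        have aux: "b * (2 * m)^2 / N^2 * N / m = b * (4 * m) / N" if "N \<noteq> 0" "m \<noteq> 0" for b m N :: real
          using that by (simp add: power2_eq_square)
        show ?thesis by (rule aux) (use k0 inR[OF z0] in auto)
      qed
      finally show ?thesis by (simp add: mult_ac)
    qed
    have tpos: "t > 0" "s > 0" using Dz Sz by (auto simp: t_def s_def)
    have "cmod (\<Psi> z) * (s * (R^2 - (cmod z)^2)) * (R^2 - (cmod z0)^2) \<le> cmod (\<Psi> z0) * (4 * Re (k z0)) * (t * Re (k z))"
      using q tpos kz inR[OF z0] by (simp add: divide_le_eq le_divide_eq mult_ac)
    moreover have "s * (R^2 - (cmod z)^2) * (R^2 - (cmod z0)^2) = s * (t - Y)"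
      using D2[of z] by (simp add: t_def Y_def)
    moreover have "4 * Re (k z0) * (t * Re (k z)) = t * (s - X)"
      using S2[of z] by (simp add: s_def X_def)
    ultimately have le: "cmod (\<Psi> z) * (s * (t - Y)) \<le> cmod (\<Psi> z0) * (t * (s - X))"
      by (metis mult.assoc)
    have tS: "t * (s - X) > 0" using S2[of z] tpos kz k0 by (simp add: s_def X_def)
    have gt: "t * (s - X) < s * (t - Y)" using lt' by (simp add: algebra_simps)
    have "deriv k z0 \<noteq> 0" using big inR[OF z0] by auto
    hence "cmod (\<Psi> z0) > 0" unfolding \<Psi>_def using Dpos[OF z0] Spos[OF z0] by auto
    hence "cmod (\<Psi> z0) * (t * (s - X)) < cmod (\<Psi> z0) * (s * (t - Y))" using gt by simp
    with le have "cmod (\<Psi> z) * (s * (t - Y)) < cmod (\<Psi> z0) * (s * (t - Y))" by linarith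
    thus ?thesis using gt tS by (simp add: mult_less_cancel_right)
  qed
  have "\<Psi> constant_on ball z0 r"
  proof (rule maximum_modulus_principle[where U = "ball z0 r" and \<xi> = z0])
    show "\<Psi> holomorphic_on ball z0 r" using hol\<Psi> by (rule holomorphic_on_subset) (use r in auto)
    show "cmod (\<Psi> z) \<le> cmod (\<Psi> z0)" if "z \<in> ball z0 r" for z
      using less[OF that] by (cases "z = z0") auto
  qed (use r in auto)
  moreover obtain z where "z \<in> ball z0 r" "z \<noteq> z0"
  proof
    show "z0 + of_real (r/2) \<in> ball z0 r" "z0 + of_real (r/2) \<noteq> z0" using r by (auto simp: dist_norm)
  qed
  ultimately show False using less[of z] r unfolding constant_on_def by fastforce
qed

text \<open>\<open>exp (L w)\<close> omits 0 and 1 and has modulus 1 at the centre, so Schottky's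
  theorem bounds it on a smaller disc, and Cauchy's inequality then bounds its derivative at the
  centre.\<close>

lemma landau_weak:
  obtains K :: real where "K > 0"
    and "\<And>L z d. d > 0 \<Longrightarrow> L holomorphic_on ball z d \<Longrightarrow> (\<And>w. w \<in> ball z d \<Longrightarrow> exp (L w) \<noteq> 1) \<Longrightarrow>
      Re (L z) = 0 \<Longrightarrow> cmod (deriv L z) * d \<le> K"
proof
  \<comment> \<open>Schottky's bound for radius \<open>1/2\<close> and initial modulus at most 1.
    Rescaling by \<open>d/2\<close> keeps the closed unit disc inside \<open>ball z d\<close>; this
    and the radius \<open>1/2\<close> in Cauchy's inequality turn \<open>M\<close> into
    \<open>4 * M\<close>.\<close>
  define M where "M = exp (pi * exp (pi * (2 + 2 * 1 + 12 * (1/2) / (1 - 1/2::real))))"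
  show "4 * M > 0" by (simp add: M_def)
  fix L :: "complex \<Rightarrow> complex" and z d
  assume d: "d > (0::real)" and hol: "L holomorphic_on ball z d"
    and ne: "\<And>w. w \<in> ball z d \<Longrightarrow> exp (L w) \<noteq> 1" and re: "Re (L z) = 0"
  define f where "f w = exp (L (z + of_real (d/2) * w))" for w
  have inb: "z + of_real (d/2) * w \<in> ball z d" if "w \<in> cball 0 1" for w
  proof -
    have "cmod (of_real (d/2) * w) \<le> d/2 * 1"
      unfolding norm_mult using that d by (intro mult_mono) auto
    thus ?thesis using d by (simp add: dist_norm)
  qed
  have holf: "f holomorphic_on cball 0 1"
  proof -
    have "L \<circ> (\<lambda>w. z + of_real (d/2) * w) holomorphic_on cball 0 1"
      by (intro holomorphic_on_compose_gen[OF _ hol] holomorphic_intros) (use inb in auto)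
    thus ?thesis unfolding f_def o_def by (intro holomorphic_intros)
  qed
  have f0: "cmod (f 0) \<le> 1" using re by (simp add: f_def)
  have fb: "cmod (f w) \<le> M" if "cmod w \<le> 1/2" for w
    unfolding M_def
  proof (rule Schottky[OF holf f0])
    show "\<not> (f w = 0 \<or> f w = 1)" if "w \<in> cball 0 1" for w
      using ne[OF inb[OF that]] by (simp add: f_def)
  qed (use that in auto)
  have "cmod ((deriv ^^ 1) f 0) \<le> fact 1 * M / (1/2)^1"
  proof (rule Cauchy_inequality)
    show "f holomorphic_on ball 0 (1/2)" using holf by (rule holomorphic_on_subset) auto
    show "continuous_on (cball 0 (1/2)) f"
      using holomorphic_on_imp_continuous_on[OF holf] by (rule continuous_on_subset) auto
  qed (use fb in auto)
  moreover have "deriv f 0 = exp (L z) * deriv L z * of_real (d/2)"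
  proof (rule DERIV_imp_deriv)
    have "(L has_field_derivative deriv L z) (at (z + of_real (d/2) * 0))"
      using hol d by (simp add: holomorphic_derivI)
    hence "((\<lambda>w. L (z + of_real (d/2) * w)) has_field_derivative deriv L z * of_real (d/2)) (at 0)"
      by (rule DERIV_chain2) (auto intro!: derivative_eq_intros)
    thus "(f has_field_derivative exp (L z) * deriv L z * of_real (d/2)) (at 0)"
      unfolding f_def by (auto intro!: derivative_eq_intros)
  qed
  ultimately show "cmod (deriv L z) * d \<le> 4 * M" using re d by (simp add: norm_mult)
qed

text \<open>
  The constant 2 is what makes the later bound linear in \<open>1 / Im z\<close>; the estimate from the library's
  Schottky theorem is only used where \<open>\<bar>exp (L z)\<bar> = 1\<close>, and elsewhere \<open>C + L\<close> or \<open>C - L\<close> maps to the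
  right half-plane near a maximum of the ratio.
\<close>
lemma ahlfors_landau:
  obtains C :: real where "C > 0"
    and "\<And>L z. L holomorphic_on ball 0 1 \<Longrightarrow> (\<And>w. w \<in> ball 0 1 \<Longrightarrow> exp (L w) \<noteq> 1) \<Longrightarrow> z \<in> ball 0 1 \<Longrightarrow>
      cmod (deriv L z) * (1 - (cmod z)^2) \<le> 2 * (C + \<bar>Re (L z)\<bar>)"
proof -
  obtain C :: real where C: "C > 0"
    and landau: "\<And>L z d. d > 0 \<Longrightarrow> L holomorphic_on ball z d \<Longrightarrow> (\<And>w. w \<in> ball z d \<Longrightarrow> exp (L w) \<noteq> 1) \<Longrightarrow>
      Re (L z) = 0 \<Longrightarrow> cmod (deriv L z) * d \<le> C" using landau_weak by blast
  show ?thesis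
  proof (rule that[OF C])
    fix L :: "complex \<Rightarrow> complex" and z :: complex
    assume hol: "L holomorphic_on ball 0 1" and ne: "\<And>w. w \<in> ball 0 1 \<Longrightarrow> exp (L w) \<noteq> 1"
      and z: "z \<in> ball 0 1"
    \<comment> \<open>For \<open>R < 1\<close> the ratio \<open>\<phi>\<close> is continuous on the
      closed disc and zero on its boundary, so a maximum exists and only an interior one needs
      work.\<close>
    have step: "cmod (deriv L z) * (R^2 - (cmod z)^2) \<le> 2 * R * (C + \<bar>Re (L z)\<bar>)"
      if R: "cmod z < R" "R < 1" for R
    proof -
      define \<phi> where "\<phi> w = cmod (deriv L w) * (R^2 - (cmod w)^2) / (C + \<bar>Re (L w)\<bar>)" for w
      have R0: "R > 0" using R by (smt (verit) norm_ge_zero)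
      have sub: "cball 0 R \<subseteq> ball (0::complex) 1" using R by auto
      have "continuous_on (cball 0 R) L" "continuous_on (cball 0 R) (deriv L)"
        using hol holomorphic_deriv[OF hol] sub by (auto intro: holomorphic_on_imp_continuous_on continuous_on_subset)
      hence "continuous_on (cball 0 R) \<phi>"
        unfolding \<phi>_def using C by (intro continuous_intros) (auto simp: add_nonneg_eq_0_iff)
      then obtain z0 where z0: "z0 \<in> cball 0 R" and zmax: "\<And>w. w \<in> cball 0 R \<Longrightarrow> \<phi> w \<le> \<phi> z0"
        using continuous_attains_sup[of "cball 0 R" \<phi>] R0 by (auto simp: less_imp_le)
      have "\<phi> z0 \<le> 2 * R"
      proof (cases "cmod z0 = R")
        case True
        thus ?thesis using R0 by (simp add: \<phi>_def)
      next
        case False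
        hence z0R: "cmod z0 < R" using z0 by auto
        \<comment> \<open>\<open>s\<close> is the sign of \<open>Re (L z0)\<close>; near
          \<open>z0\<close> it removes the absolute value, so that the denominator of
          \<open>\<phi>\<close> becomes the real part of a holomorphic function.\<close>
        have main: "\<phi> z0 \<le> 2 * R" if s: "s = 1 \<or> s = -1" and sp: "s * Re (L z0) > 0" for s :: real
        proof -
          define k where "k w = of_real C + of_real s * L w" for w
          have "isCont L z0" using hol z0R R
            by (metis analytic_at_imp_isCont holomorphic_on_imp_analytic_at less_trans mem_ball_0 open_ball)
          hence "(L \<longlongrightarrow> L z0) (nhds z0)" by (simp add: isCont_def tendsto_at_iff_tendsto_nhds)
          hence "((\<lambda>w. s * Re (L w)) \<longlongrightarrow> s * Re (L z0)) (nhds z0)" by (intro tendsto_intros)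
          hence "\<forall>\<^sub>F w in nhds z0. s * Re (L w) > 0"
            using sp by (rule order_tendstoD)
          then obtain e1 where e1: "e1 > 0" "\<And>w. dist w z0 < e1 \<Longrightarrow> s * Re (L w) > 0"
            unfolding eventually_nhds_metric by blast
          define e where "e = min e1 (R - cmod z0)"
          have e: "e > 0" using e1 z0R by (simp add: e_def)
          have eR: "ball z0 e \<subseteq> ball 0 R"
          proof
            fix w assume "w \<in> ball z0 e"
            hence "cmod (w - z0) < R - cmod z0" by (simp add: e_def dist_norm norm_minus_commute)
            thus "w \<in> ball 0 R" using norm_triangle_ineq2[of w z0] by simp
          qed
          have ab: "s * Re (L w) = \<bar>Re (L w)\<bar>" if "w \<in> ball z0 e" for w
            using e1(2)[of w] that s by (auto simp: e_def dist_commute)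
          have holk: "k holomorphic_on ball z0 e" unfolding k_def
            by (intro holomorphic_intros holomorphic_on_subset[OF hol]) (use eR R in auto)
          have dk: "cmod (deriv k w) = cmod (deriv L w)" if "w \<in> ball z0 e" for w
          proof -
            have "w \<in> ball 0 1" using that eR R by auto
            hence "(L has_field_derivative deriv L w) (at w)" using hol by (simp add: holomorphic_derivI)
            hence "deriv k w = of_real s * deriv L w" unfolding k_def
              by (intro DERIV_imp_deriv) (auto intro!: derivative_eq_intros)
            thus ?thesis using s by (auto simp: norm_mult)
          qed
          have Rek: "Re (k w) = C + \<bar>Re (L w)\<bar>" if "w \<in> ball z0 e" for w
            using ab[OF that] by (simp add: k_def)
          have eq: "\<phi> w = cmod (deriv k w) * (R^2 - (cmod w)^2) / Re (k w)" if "w \<in> ball z0 e" for w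
            using dk[OF that] Rek[OF that] by (simp add: \<phi>_def)
          have zz: "z0 \<in> ball z0 e" using e by simp
          have "cmod (deriv k z0) * (R^2 - (cmod z0)^2) / Re (k z0) \<le> 2 * R"
          proof (rule hyperbolic_ratio_local_max_le[OF e eR holk])
            show "Re (k w) > 0" if "w \<in> ball z0 e" for w using Rek[OF that] C by simp
            show "cmod (deriv k w) * (R^2 - (cmod w)^2) / Re (k w) \<le> cmod (deriv k z0) * (R^2 - (cmod z0)^2) / Re (k z0)"
              if "w \<in> ball z0 e" for w
              using zmax[of w] that eR eq[OF that] eq[OF zz] by (auto simp: subset_eq less_imp_le)
          qed
          thus ?thesis using eq[OF zz] by simp
        qed
        consider "Re (L z0) > 0" | "Re (L z0) < 0" | "Re (L z0) = 0" by linarith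
        thus ?thesis
        proof cases
          case 1 thus ?thesis using main[of 1] by simp
        next
          case 2 thus ?thesis using main[of "-1"] by simp
        next
          case 3
          have sub0: "ball z0 (R - cmod z0) \<subseteq> ball 0 1"
          proof
            fix w assume "w \<in> ball z0 (R - cmod z0)"
            hence "cmod (w - z0) < R - cmod z0" by (simp add: dist_norm norm_minus_commute)
            thus "w \<in> ball 0 1" using norm_triangle_ineq2[of w z0] R by simp
          qed
          have "cmod (deriv L z0) * (R - cmod z0) \<le> C"
            using 3 z0R sub0 ne by (intro landau holomorphic_on_subset[OF hol]) auto
          \<comment> \<open>The product of the two factors is the density at \<open>z0\<close>, and
            the second is at most \<open>2 * R\<close>.\<close>
          hence "cmod (deriv L z0) * (R - cmod z0) * (R + cmod z0) \<le> C * (2 * R)"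
            using z0R R0 C by (intro mult_mono) auto
          thus ?thesis using 3 C by (simp add: \<phi>_def field_simps power2_eq_square)
        qed
      qed
      hence "\<phi> z \<le> 2 * R" using zmax[of z] R by auto
      thus ?thesis using C unfolding \<phi>_def by (simp add: divide_le_eq)
    qed
    have "((\<lambda>R. 2 * R * (C + \<bar>Re (L z)\<bar>)) \<longlongrightarrow> 2 * 1 * (C + \<bar>Re (L z)\<bar>)) (at_left 1)"
      by (intro tendsto_intros)
    moreover have "((\<lambda>R. cmod (deriv L z) * (R^2 - (cmod z)^2)) \<longlongrightarrow> cmod (deriv L z) * (1^2 - (cmod z)^2)) (at_left 1)"
      by (intro tendsto_intros)
    moreover have "\<forall>\<^sub>F R in at_left 1. cmod (deriv L z) * (R^2 - (cmod z)^2) \<le> 2 * R * (C + \<bar>Re (L z)\<bar>)"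
      using z step by (auto simp: eventually_at_left[of "cmod z" 1])
    ultimately show "cmod (deriv L z) * (1 - (cmod z)^2) \<le> 2 * (C + \<bar>Re (L z)\<bar>)"
      using tendsto_le[of "at_left (1::real)"] by fastforce
  qed
qed

section \<open>From the derivative bound to growth in the disc and the half-plane\<close>

lemma growth_along_radius:
  fixes L :: "complex \<Rightarrow> complex" and C :: real
  assumes C: "C > 0" and hol: "L holomorphic_on ball 0 1"
    and bd: "\<And>w. w \<in> ball 0 1 \<Longrightarrow> cmod (deriv L w) * (1 - (cmod w)^2) \<le> 2 * (C + \<bar>Re (L w)\<bar>)"
    and z: "z \<in> ball 0 1"
  shows "Re (L z) * (1 - cmod z) \<le> (C + \<bar>Re (L 0)\<bar>) * (1 + cmod z)"
proof -
  define r where "r = cmod z"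
  have r: "0 \<le> r" "r < 1" using z by (auto simp: r_def)
  define U where "U t = Re (L (of_real t * z))" for t
  have inb: "of_real t * z \<in> ball 0 1" and tr: "t * r < 1" if "0 \<le> t" "t \<le> 1" for t :: real
  proof -
    have "t * r \<le> 1 * r" using that r by (intro mult_right_mono) auto
    thus "t * r < 1" using r by simp
    thus "of_real t * z \<in> ball 0 1" using that by (simp add: r_def norm_mult)
  qed
  have Uder: "(U has_real_derivative Re (deriv L (of_real t * z) * z)) (at t)" if "0 \<le> t" "t \<le> 1" for t
  proof -
    have "(L has_field_derivative deriv L (of_real t * z)) (at (of_real t * z))"
      using hol inb[OF that] by (simp add: holomorphic_derivI)
    hence "((\<lambda>x. L (x * z)) has_field_derivative deriv L (of_real t * z) * z) (at (of_real t))"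
      by (rule DERIV_chain2) (auto intro!: derivative_eq_intros)
    thus ?thesis unfolding U_def by (intro has_field_derivative_Re has_vector_derivative_real_field)
  qed
  have Ucont: "continuous_on {0..1} U"
    using Uder by (auto intro!: continuous_at_imp_continuous_on DERIV_isCont)
  define m where "m = \<bar>Re (L 0)\<bar>"
  \<comment> \<open>After the last time \<open>a\<close> at which \<open>U \<le> m\<close>, \<open>U\<close> is positive, so the absolute value in \<open>bd\<close> can be dropped.\<close>
  define T where "T = {0..1} \<inter> U -` {..m}"
  have "closed T" unfolding T_def by (intro continuous_closed_preimage Ucont) auto
  have Tsub: "T \<subseteq> {0..1}" by (auto simp: T_def)
  have T0: "0 \<in> T" by (auto simp: T_def U_def m_def)
  have bdd: "bdd_above T" by (rule bdd_above_mono[OF _ Tsub]) simp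
  define a where "a = Sup T"
  have aT: "a \<in> T" unfolding a_def using T0 bdd \<open>closed T\<close> by (intro closed_contains_Sup) auto
  hence a: "0 \<le> a" "a \<le> 1" "U a \<le> m" by (auto simp: T_def)
  have above: "U t > m" if "a < t" "t \<le> 1" for t
  proof (rule ccontr)
    assume "\<not> ?thesis"
    hence "t \<in> T" using that a by (auto simp: T_def)
    thus False using cSup_upper[OF _ bdd, of t] that by (simp add: a_def)
  qed
  \<comment> \<open>The bound reads \<open>(C + U)' \<le> 2 * r / (1 - t^2 * r^2) * (C + U)\<close>,
    with equality for multiples of \<open>(1 + t * r) / (1 - t * r)\<close>. Dividing by this
    solution makes \<open>W\<close> nonincreasing; a constant above 2 would give a higher power of
    it.\<close>
  define W where "W t = (C + U t) * ((1 - t * r) / (1 + t * r))" for t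
  have tr1: "1 + t * r > 0" if "0 \<le> t" for t
    using that r by (smt (verit) mult_nonneg_nonneg)
  have ne: "1 + t * r \<noteq> 0" if "t \<in> {a..1}" for t using tr1[of t] that a by auto
  have "W 1 \<le> W a"
  proof (rule DERIV_nonpos_imp_decreasing_open[OF a(2)])
    show "continuous_on {a..1} W" unfolding W_def
      by (intro continuous_intros continuous_on_subset[OF Ucont]) (use a ne in auto)
  next
    fix t assume t: "a < t" "t < 1"
    have t01: "0 \<le> t" "t \<le> 1" using t a by auto
    define d where "d = Re (deriv L (of_real t * z) * z)"
    have p: "1 + t * r > 0" "1 - t * r > 0" using tr1[OF t01(1)] tr[OF t01] by auto
    have "(W has_real_derivative d * ((1 - t * r) / (1 + t * r)) + (C + U t) * (((- r) * (1 + t * r) - (1 - t * r) * r) / (1 + t * r)^2)) (at t)"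
    proof -
      have quot: "((\<lambda>t. (1 - t * r) / (1 + t * r)) has_real_derivative
          (((- r) * (1 + t * r) - (1 - t * r) * r) / (1 + t * r)^2)) (at t)"
        using p by (auto intro!: derivative_eq_intros simp: power2_eq_square)
      have "((\<lambda>t. C + U t) has_real_derivative d) (at t)"
        unfolding d_def using Uder[OF t01] by (auto intro!: derivative_eq_intros)
      from DERIV_mult[OF this quot] show ?thesis unfolding W_def by (simp add: algebra_simps)
    qed
    moreover have "d * ((1 - t * r) / (1 + t * r)) + (C + U t) * (((- r) * (1 + t * r) - (1 - t * r) * r) / (1 + t * r)^2)
       = (d * ((1 - t * r) * (1 + t * r)) - 2 * r * (C + U t)) / (1 + t * r)^2"
      using p by (simp add: divide_simps power2_eq_square) (simp add: algebra_simps)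
    moreover have "d * ((1 - t * r) * (1 + t * r)) \<le> 2 * r * (C + U t)"
    proof -
      have "d \<le> cmod (deriv L (of_real t * z)) * r" unfolding d_def r_def norm_mult[symmetric] by (rule complex_Re_le_cmod)
      hence "d * ((1 - t * r) * (1 + t * r)) \<le> cmod (deriv L (of_real t * z)) * r * ((1 - t * r) * (1 + t * r))"
        using p by (intro mult_right_mono) auto
      also have "\<dots> = r * (cmod (deriv L (of_real t * z)) * (1 - (cmod (of_real t * z))^2))"
        by (simp add: norm_mult r_def algebra_simps power2_eq_square)
      also have "\<dots> \<le> r * (2 * (C + \<bar>Re (L (of_real t * z))\<bar>))"
        using r by (intro mult_left_mono bd inb t01)
      also have "\<bar>Re (L (of_real t * z))\<bar> = U t" using above[of t] t by (simp add: U_def m_def)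
      finally show ?thesis by (simp add: algebra_simps)
    qed
    ultimately show "\<exists>y. (W has_real_derivative y) (at t) \<and> y \<le> 0"
      by (auto intro!: exI divide_nonpos_nonneg)
  qed
  also have "W a \<le> (C + m) * 1"
  proof -
    have "(1 - a * r) / (1 + a * r) \<le> 1" "0 \<le> (1 - a * r) / (1 + a * r)" using a r tr[of a] tr1[of a] by auto
    moreover have "C + U a \<le> C + m" "0 \<le> C + m" using a C by (auto simp: m_def)
    ultimately show ?thesis unfolding W_def by (intro mult_mono)
  qed
  finally have "(C + U 1) * ((1 - r) / (1 + r)) \<le> C + m" by (simp add: W_def)
  hence "(C + U 1) * (1 - r) \<le> (C + m) * (1 + r)" using r by (simp add: field_simps)
  moreover have "0 \<le> C * (1 - r)" using C r by simp
  ultimately show ?thesis by (simp add: U_def m_def r_def algebra_simps)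
qed

lemma halfplane_growth:
  assumes hol: "L holomorphic_on {z. Im z > 0}" and ne: "\<And>w. Im w > 0 \<Longrightarrow> exp (L w) \<noteq> 1"
  obtains A :: real where "\<And>z. Im z > 0 \<Longrightarrow> \<bar>Re (L z)\<bar> \<le> A * (1 + (cmod z)^2) / Im z"
proof -
  obtain C :: real where C: "C > 0" and AL: "\<And>L z. L holomorphic_on ball 0 1 \<Longrightarrow>
      (\<And>w. w \<in> ball 0 1 \<Longrightarrow> exp (L w) \<noteq> 1) \<Longrightarrow> z \<in> ball 0 1 \<Longrightarrow>
      cmod (deriv L z) * (1 - (cmod z)^2) \<le> 2 * (C + \<bar>Re (L z)\<bar>)"
    using ahlfors_landau by blast
  show ?thesis
  proof (rule that[of "C + \<bar>Re (L \<i>)\<bar>"])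
    fix z assume z: "Im z > 0"
    define cay where "cay w = \<i> * (1 + w) / (1 - w)" for w
    have cay: "Im (cay w) > 0" if "w \<in> ball 0 1" for w
    proof -
      have "1 - w \<noteq> 0" using that by auto
      hence pos: "(cmod (1 - w))^2 > 0" by simp
      have "Im (cay w) = (1 - (cmod w)^2) / (cmod (1 - w))^2"
        unfolding cay_def cmod_power2 by (simp add: Im_divide) (simp add: algebra_simps power2_eq_square)
      moreover have "(cmod w)^2 < 1" using that by (simp add: abs_square_less_1)
      ultimately show ?thesis using pos by simp
    qed
    have "cay holomorphic_on ball 0 1" unfolding cay_def by (intro holomorphic_intros) auto
    hence holc: "L \<circ> cay holomorphic_on ball 0 1"
      by (rule holomorphic_on_compose_gen[OF _ hol]) (use cay in auto)
    define w where "w = (z - \<i>) / (z + \<i>)"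
    have nz: "z + \<i> \<noteq> 0" using z by (auto simp: complex_eq_iff)
    have cw: "cay w = z"
    proof -
      have "1 - w = 2 * \<i> / (z + \<i>)" "1 + w = 2 * z / (z + \<i>)" using nz by (auto simp: w_def field_simps)
      thus ?thesis using nz by (simp add: cay_def)
    qed
    have p: "(cmod (z + \<i>))^2 = (cmod z)^2 + 1 + 2 * Im z" and q: "(cmod (z - \<i>))^2 = (cmod z)^2 + 1 - 2 * Im z"
      unfolding cmod_power2 by (auto simp: power2_eq_square algebra_simps)
    \<comment> \<open>\<open>(1 + cmod w) / (1 - cmod w)\<close> equals
      \<open>(P + Q)^2 / (P^2 - Q^2)\<close>, whose denominator is \<open>4 * Im z\<close> and whose
      numerator is at most \<open>4 * (1 + (cmod z)^2)\<close>.\<close>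
    define P Q where "P = cmod (z + \<i>)" and "Q = cmod (z - \<i>)"
    have PQ: "P > 0" "Q \<ge> 0" "Q < P"
    proof -
      show "P > 0" "Q \<ge> 0" using nz by (auto simp: P_def Q_def)
      have "Q^2 < P^2" using p q z by (simp add: P_def Q_def)
      thus "Q < P" using \<open>P > 0\<close> by (simp add: power2_less_imp_less)
    qed
    have wQ: "cmod w = Q / P" by (simp add: w_def P_def Q_def norm_divide)
    have wb: "w \<in> ball 0 1" using PQ by (simp add: wQ)
    \<comment> \<open>The radial estimate bounds real parts from above only; \<open>-L\<close> also
      qualifies, since \<open>exp (-L)\<close> is 1 exactly where \<open>exp L\<close> is.\<close>
    have key: "s * Re (L z) * (1 - cmod w) \<le> (C + \<bar>Re (L \<i>)\<bar>) * (1 + cmod w)" if s: "s = 1 \<or> s = -1" for s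
    proof -
      define M where "M w = of_real s * (L \<circ> cay) w" for w
      have holM: "M holomorphic_on ball 0 1" unfolding M_def by (intro holomorphic_intros holc)
      have neM: "exp (M v) \<noteq> 1" if "v \<in> ball 0 1" for v
        using s ne[OF cay[OF that]] by (auto simp: M_def exp_minus)
      have "Re (M w) * (1 - cmod w) \<le> (C + \<bar>Re (M 0)\<bar>) * (1 + cmod w)"
        by (intro growth_along_radius C holM wb AL neM)
      moreover have "\<bar>Re (M 0)\<bar> = \<bar>Re (L \<i>)\<bar>" using s by (auto simp: M_def cay_def)
      ultimately show ?thesis by (simp add: M_def cw)
    qed
    have "\<bar>Re (L z)\<bar> * (1 - cmod w) \<le> (C + \<bar>Re (L \<i>)\<bar>) * (1 + cmod w)"
      using key[of 1] key[of "-1"] by (auto simp: abs_if)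
    moreover have "1 - cmod w = (P - Q) / P" "1 + cmod w = (P + Q) / P"
      using PQ by (auto simp: wQ diff_divide_distrib add_divide_distrib)
    ultimately have "\<bar>Re (L z)\<bar> * (P - Q) \<le> (C + \<bar>Re (L \<i>)\<bar>) * (P + Q)"
      using PQ by (simp add: divide_le_cancel)
    hence "\<bar>Re (L z)\<bar> * (P - Q) * (P + Q) \<le> (C + \<bar>Re (L \<i>)\<bar>) * (P + Q) * (P + Q)"
      using PQ by (intro mult_right_mono) auto
    also have "\<bar>Re (L z)\<bar> * (P - Q) * (P + Q) = \<bar>Re (L z)\<bar> * (4 * Im z)"
    proof -
      have "(P - Q) * (P + Q) = 4 * Im z"
        using p q by (simp add: P_def Q_def algebra_simps power2_eq_square)
      thus ?thesis by (simp only: mult.assoc)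
    qed
    also have "(C + \<bar>Re (L \<i>)\<bar>) * (P + Q) * (P + Q) \<le> (C + \<bar>Re (L \<i>)\<bar>) * (4 * (1 + (cmod z)^2))"
    proof -
      have "(P + Q) * (P + Q) \<le> 2 * (P^2 + Q^2)"
        using zero_le_power2[of "P - Q"] by (simp add: power2_eq_square algebra_simps)
      also have "\<dots> = 4 * (1 + (cmod z)^2)" using p q by (simp add: P_def Q_def)
      finally show ?thesis using C by (auto simp: mult.assoc intro!: mult_left_mono)
    qed
    finally show "\<bar>Re (L z)\<bar> \<le> (C + \<bar>Re (L \<i>)\<bar>) * (1 + (cmod z)^2) / Im z"
      using z by (simp add: field_simps)
  qed
qed

section \<open>Real entire functions of restricted growth\<close>

text \<open>Lets the weight \<open>sin (n * t)\<close> absorb the factor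
  \<open>1 / \<bar>sin t\<bar>\<close> that \<open>1 / Im z\<close> contributes on a circle about
  0.\<close>

lemma abs_sin_multiple_le: "\<bar>sin (real n * t)\<bar> \<le> real n * \<bar>sin t\<bar>"
proof (induction n)
  case (Suc n)
  have "\<bar>sin (real (Suc n) * t)\<bar> = \<bar>sin (real n * t) * cos t + cos (real n * t) * sin t\<bar>"
    by (simp add: algebra_simps sin_add)
  also have "\<dots> \<le> \<bar>sin (real n * t)\<bar> * \<bar>cos t\<bar> + \<bar>cos (real n * t)\<bar> * \<bar>sin t\<bar>"
    by (metis abs_mult abs_triangle_ineq)
  also have "\<dots> \<le> \<bar>sin (real n * t)\<bar> * 1 + 1 * \<bar>sin t\<bar>"
    by (intro add_mono mult_left_mono mult_right_mono) auto
  finally show ?case using Suc.IH by (simp add: algebra_simps)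
qed simp

lemma real_entire_cnj:
  assumes hol: "b holomorphic_on UNIV" and real: "\<And>x::real. b (of_real x) \<in> \<real>"
  shows "b (cnj z) = cnj (b z)"
proof -
  have hol': "(cnj \<circ> b \<circ> cnj) holomorphic_on UNIV"
    by (rule holomorphic_on_compose_cnj_cnj) (use hol holomorphic_on_subset in auto)
  have "(\<lambda>z. (cnj \<circ> b \<circ> cnj) z - b z) z = 0"
  proof (rule analytic_continuation[where f = "\<lambda>z. (cnj \<circ> b \<circ> cnj) z - b z" and S = UNIV and U = "\<real>" and \<xi> = 0])
    show "(\<lambda>z. (cnj \<circ> b \<circ> cnj) z - b z) holomorphic_on UNIV" by (intro holomorphic_intros hol hol')
    show "0 islimpt (\<real> :: complex set)"
    proof (subst islimpt_approachable, intro allI impI)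
      fix e :: real assume "e > 0"
      thus "\<exists>x'\<in>\<real>. x' \<noteq> 0 \<and> dist x' (0::complex) < e"
        by (intro bexI[of _ "of_real (e/2)"]) auto
    qed
    show "(cnj \<circ> b \<circ> cnj) w - b w = 0" if w: "w \<in> \<real>" for w
    proof -
      obtain x where "w = of_real x" using w by (rule Reals_cases)
      thus ?thesis using real[of x] by (simp add: Reals_cnj_iff)
    qed
  qed auto
  hence "cnj (b (cnj z)) = b z" by simp
  thus ?thesis by (metis complex_cnj_cnj)
qed

lemma higher_deriv_real:
  assumes hol: "b holomorphic_on UNIV" and real: "\<And>x::real. b (of_real x) \<in> \<real>"
  shows "(deriv ^^ n) b (of_real x) \<in> \<real>"
proof (induction n arbitrary: x)
  case (Suc n)
  let ?g = "(deriv ^^ n) b"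
  have "?g holomorphic_on UNIV" using hol by (simp add: holomorphic_higher_deriv)
  hence "(?g has_field_derivative deriv ?g (of_real x)) (at (of_real x))" by (simp add: holomorphic_derivI)
  hence "((\<lambda>t::real. ?g (of_real t)) has_vector_derivative deriv ?g (of_real x)) (at x)"
    by (rule has_vector_derivative_real_field)
  hence "((\<lambda>t. Im (?g (of_real t))) has_field_derivative Im (deriv ?g (of_real x))) (at x)"
    by (rule has_field_derivative_Im)
  moreover have "(\<lambda>t. Im (?g (of_real t))) = (\<lambda>t. 0)" using Suc.IH by (auto simp: complex_is_Real_iff)
  ultimately have "Im (deriv ?g (of_real x)) = 0" using DERIV_unique[OF _ DERIV_const] by fastforce
  thus ?case by (simp add: complex_is_Real_iff)
qed (use real in simp)

text \<open>\<open>sin (n * t)\<close> combines \<open>cis (- n * t)\<close> and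
  \<open>cis (n * t)\<close>: integrated against \<open>b\<close>, the first picks out the
  coefficient of order \<open>n\<close> by Cauchy's formula, the second gives 0 by Cauchy's
  theorem.\<close>

lemma has_integral_sin_taylor_coeff:
  assumes hol: "b holomorphic_on UNIV" and n: "n > 0" and r: "r > 0"
  shows "((\<lambda>t. sin (real n * t) * Im (b (of_real r * cis t))) has_integral
           pi * r ^ n * Re ((deriv ^^ n) b 0 / fact n)) {0..2*pi}"
proof -
  define c where "c = (deriv ^^ n) b 0 / fact n"
  have "((\<lambda>u. b u / (u - 0) ^ Suc n) has_contour_integral ((2 * pi * \<i>) / (fact n) * (deriv ^^ n) b 0)) (circlepath 0 r)"
    using hol r by (intro Cauchy_has_contour_integral_higher_derivative_circlepath)
      (auto intro: holomorphic_on_imp_continuous_on holomorphic_on_subset)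
  hence 1: "((\<lambda>t. b (0 + of_real r * cis t) / (0 + of_real r * cis t - 0) ^ Suc n * of_real r * \<i> * cis t) has_integral
      2 * pi * \<i> * c) {0..2*pi}"
    unfolding circlepath_def by (subst (asm) has_contour_integral_part_circlepath_iff) (auto simp: c_def)
  have "((\<lambda>u. b u * u ^ (n - 1)) has_contour_integral 0) (circlepath 0 r)"
    by (rule Cauchy_theorem_convex_simple[of _ UNIV]) (auto intro!: holomorphic_intros hol)
  hence 2: "((\<lambda>t. b (0 + of_real r * cis t) * (0 + of_real r * cis t) ^ (n - 1) * of_real r * \<i> * cis t) has_integral 0) {0..2*pi}"
    unfolding circlepath_def by (subst (asm) has_contour_integral_part_circlepath_iff) auto
  \<comment> \<open>The weights cancel the powers of \<open>r\<close> and leave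
    \<open>\<i> / 2 * (cis (- n * t) - cis (n * t))\<close>, which is
    \<open>sin (n * t)\<close>.\<close>
  have 3: "((\<lambda>t. of_real r ^ n / 2 * (b (0 + of_real r * cis t) / (0 + of_real r * cis t - 0) ^ Suc n * of_real r * \<i> * cis t)
      - 1 / (2 * of_real r ^ n) * (b (0 + of_real r * cis t) * (0 + of_real r * cis t) ^ (n - 1) * of_real r * \<i> * cis t))
      has_integral (of_real r ^ n / 2 * (2 * pi * \<i> * c) - 1 / (2 * of_real r ^ n) * 0)) {0..2*pi}"
    by (intro has_integral_diff has_integral_mult_right 1 2)
  have eq: "of_real r ^ n / 2 * (b (0 + of_real r * cis t) / (0 + of_real r * cis t - 0) ^ Suc n * of_real r * \<i> * cis t)
      - 1 / (2 * of_real r ^ n) * (b (0 + of_real r * cis t) * (0 + of_real r * cis t) ^ (n - 1) * of_real r * \<i> * cis t)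
      = of_real (sin (real n * t)) * b (of_real r * cis t)" for t
  proof -
    define B where "B = b (of_real r * cis t)"
    have rr: "complex_of_real r \<noteq> 0" using r by simp
    have "of_real r ^ n / 2 * (B / (of_real r * cis t) ^ Suc n * of_real r * \<i> * cis t) = B * \<i> / 2 * (1 / cis t ^ n)"
      using rr by (simp add: power_mult_distrib divide_simps)
    also have "1 / cis t ^ n = cis (- (real n * t))"
      by (simp add: Complex.DeMoivre cis_inverse[symmetric] divide_inverse del: cis_inverse)
    finally have e1: "of_real r ^ n / 2 * (B / (of_real r * cis t) ^ Suc n * of_real r * \<i> * cis t) = B * \<i> / 2 * cis (- (real n * t))" .
    have "(of_real r * cis t) ^ (n - 1) * (of_real r * cis t) = (of_real r * cis t) ^ n"
      using n by (metis power_minus_mult)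
    hence "1 / (2 * of_real r ^ n) * (B * (of_real r * cis t) ^ (n - 1) * of_real r * \<i> * cis t)
       = 1 / (2 * of_real r ^ n) * (B * \<i> * (of_real r * cis t) ^ n)" by (simp add: mult_ac)
    also have "\<dots> = B * \<i> / 2 * cis (real n * t)" using rr by (simp add: power_mult_distrib Complex.DeMoivre)
    finally have e2: "1 / (2 * of_real r ^ n) * (B * (of_real r * cis t) ^ (n - 1) * of_real r * \<i> * cis t) = B * \<i> / 2 * cis (real n * t)" .
    have "cis (- (real n * t)) - cis (real n * t) = - (2 * \<i> * of_real (sin (real n * t)))"
      by (simp add: complex_eq_iff)
    hence "B * \<i> / 2 * cis (- (real n * t)) - B * \<i> / 2 * cis (real n * t) = B * of_real (sin (real n * t))"
      by (simp only: right_diff_distrib[symmetric]) simp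
    thus ?thesis unfolding add_0_left diff_zero B_def[symmetric] e1 e2 by (simp add: mult.commute)
  qed
  have "((\<lambda>t. of_real (sin (real n * t)) * b (of_real r * cis t)) has_integral (of_real r ^ n * pi * \<i> * c)) {0..2*pi}"
    using 3 unfolding eq by (simp add: mult.assoc)
  from has_integral_linear[OF this bounded_linear_Im]
  have "((\<lambda>t. Im (of_real (sin (real n * t)) * b (of_real r * cis t))) has_integral Im (of_real r ^ n * pi * \<i> * c)) {0..2*pi}"
    by (simp add: o_def)
  moreover have "Im (of_real r ^ n * pi * \<i> * c) = pi * r ^ n * Re c"
    by (simp flip: of_real_power add: mult_ac)
  ultimately show ?thesis by (simp add: c_def)
qed

text \<open>Integrating against \<open>sin (n * t)\<close> over a circle bounds the coefficients of
  order \<open>n \<ge> 2\<close> by a multiple of \<open>1 / r\<close>. Reality on the line makes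
  bounds on their real parts sufficient and carries the growth bound to the lower
  half-plane.\<close>

lemma entire_affine_if_growth:
  fixes b :: "complex \<Rightarrow> complex" and A :: real
  assumes hol: "b holomorphic_on UNIV" and real: "\<And>x::real. b (of_real x) \<in> \<real>"
    and growth: "\<And>z. Im z > 0 \<Longrightarrow> \<bar>Im (b z)\<bar> \<le> A * (1 + (cmod z)^2) / Im z"
  obtains c d :: real where "\<And>z. b z = of_real c * z + of_real d"
proof -
  define a where "a n = (deriv ^^ n) b 0 / fact n" for n
  have areal: "a n \<in> \<real>" for n
    unfolding a_def using higher_deriv_real[OF hol real, of n 0]
    by (metis Reals_divide Reals_of_real of_real_0 of_real_fact)
  have A0: "A \<ge> 0" using growth[of \<i>] by (auto intro: order_trans[OF abs_ge_zero])
  \<comment> \<open>Clearing the denominator extends the bound to the whole plane, real axis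
    included.\<close>
  have growth': "\<bar>Im (b z)\<bar> * \<bar>Im z\<bar> \<le> A * (1 + (cmod z)^2)" for z
  proof -
    consider "Im z > 0" | "Im z < 0" | "Im z = 0" by linarith
    thus ?thesis
    proof cases
      case 1 thus ?thesis using growth[of z] by (simp add: le_divide_eq)
    next
      case 2
      hence "\<bar>Im (b (cnj z))\<bar> * \<bar>Im z\<bar> \<le> A * (1 + (cmod z)^2)" using growth[of "cnj z"] by (simp add: field_simps)
      thus ?thesis by (simp add: real_entire_cnj[OF hol real])
    next
      case 3 thus ?thesis using A0 by simp
    qed
  qed
  have bound: "\<bar>Re (a n)\<bar> \<le> 4 * real n * A / r" if n: "n \<ge> 2" and r: "r \<ge> 1" for n r
  proof -
    have "norm (pi * r ^ n * Re ((deriv ^^ n) b 0 / fact n)) \<le> real n * (A * (1 + r^2) / r) * measure lborel (cbox 0 (2*pi))"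
    proof (rule has_integral_bound)
      show "((\<lambda>t. sin (real n * t) * Im (b (of_real r * cis t))) has_integral
           pi * r ^ n * Re ((deriv ^^ n) b 0 / fact n)) (cbox 0 (2*pi))"
        unfolding cbox_interval using n r by (intro has_integral_sin_taylor_coeff hol) auto
      show "0 \<le> real n * (A * (1 + r^2) / r)" using A0 r by simp
      fix t
      have "\<bar>Im (b (of_real r * cis t))\<bar> * \<bar>r * sin t\<bar> \<le> A * (1 + r^2)"
        using growth'[of "of_real r * cis t"] r by (simp add: norm_mult)
      hence "\<bar>Im (b (of_real r * cis t))\<bar> * \<bar>sin t\<bar> \<le> A * (1 + r^2) / r"
        using r by (simp add: abs_mult field_simps)
      hence "real n * (\<bar>Im (b (of_real r * cis t))\<bar> * \<bar>sin t\<bar>) \<le> real n * (A * (1 + r^2) / r)"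
        by (intro mult_left_mono) auto
      moreover have "\<bar>sin (real n * t)\<bar> * \<bar>Im (b (of_real r * cis t))\<bar> \<le> real n * \<bar>sin t\<bar> * \<bar>Im (b (of_real r * cis t))\<bar>"
        by (intro mult_right_mono abs_sin_multiple_le) auto
      ultimately show "norm (sin (real n * t) * Im (b (of_real r * cis t))) \<le> real n * (A * (1 + r^2) / r)"
        by (simp add: abs_mult mult_ac)
    qed
    hence "pi * (r ^ n * \<bar>Re (a n)\<bar>) \<le> pi * (2 * real n * (A * (1 + r^2) / r))"
      using r by (simp add: abs_mult a_def mult_ac)
    hence "r ^ n * \<bar>Re (a n)\<bar> \<le> 2 * real n * (A * (1 + r^2) / r)"
      by (simp only: mult_le_cancel_left_pos pi_gt_zero)
    also have "\<dots> \<le> 2 * real n * (A * (2 * r^2) / r)"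
      using A0 r by (intro mult_left_mono divide_right_mono) (auto simp: one_le_power)
    finally have "r^2 * \<bar>Re (a n)\<bar> \<le> r^2 * (4 * real n * A / r)"
    proof -
      assume h: "r ^ n * \<bar>Re (a n)\<bar> \<le> 2 * real n * (A * (2 * r^2) / r)"
      \<comment> \<open>\<open>n \<ge> 2\<close> is decisive: the right side grows like
        \<open>r\<close>, so two powers of \<open>r\<close> on the left are needed for
        decay.\<close>
      have "r^2 * \<bar>Re (a n)\<bar> \<le> r ^ n * \<bar>Re (a n)\<bar>" using n r by (intro mult_right_mono power_increasing) auto
      also note h
      finally show ?thesis by (simp add: mult_ac)
    qed
    moreover have "r^2 > 0" using r by simp
    ultimately show ?thesis by (simp only: mult_le_cancel_left_pos)
  qed
  have a0: "a n = 0" if n: "n \<ge> 2" for n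
  proof -
    have "((\<lambda>r. 4 * real n * A / r) \<longlongrightarrow> 0) at_top" by real_asymp
    moreover have "\<forall>\<^sub>F r in at_top. \<bar>Re (a n)\<bar> \<le> 4 * real n * A / r"
      using eventually_ge_at_top[of 1] by eventually_elim (rule bound[OF n])
    ultimately have "\<bar>Re (a n)\<bar> \<le> 0" by (intro tendsto_lowerbound) auto
    thus ?thesis using areal[of n] by (simp add: complex_eq_iff complex_is_Real_iff)
  qed
  have val: "b z = a 0 + a 1 * z" for z
  proof -
    have "(\<lambda>n. (deriv ^^ n) b 0 / fact n * (z - 0) ^ n) sums b z"
      by (rule holomorphic_power_series[where r = "cmod z + 1"]) (use hol holomorphic_on_subset in auto)
    hence "(\<lambda>n. a n * z ^ n) sums b z" by (simp add: a_def)
    moreover have "(\<lambda>n. a n * z ^ n) sums (\<Sum>n\<in>{0,1}. a n * z ^ n)"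
      by (rule sums_finite) (use a0 in \<open>auto simp: not_less_eq_eq numeral_2_eq_2\<close>)
    ultimately show ?thesis using sums_unique2 by fastforce
  qed
  show ?thesis
  proof (rule that[of "Re (a 1)" "Re (a 0)"])
    show "b z = of_real (Re (a 1)) * z + of_real (Re (a 0))" for z
      using areal[of 0] areal[of 1] by (simp add: val of_real_Re)
  qed
qed

section \<open>Entire functions with real zeros and their reflections\<close>

lemma holomorphic_cnj_cnj_UNIV:
  assumes "f holomorphic_on UNIV"
  shows "(\<lambda>z. cnj (f (cnj z))) holomorphic_on UNIV"
proof -
  have "(cnj \<circ> f \<circ> cnj) holomorphic_on UNIV"
    by (rule holomorphic_on_compose_cnj_cnj) (use assms holomorphic_on_subset in auto)
  thus ?thesis by (simp add: o_def)
qed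

text \<open>Reflection fixes real points, so conjugating the local factorization
  \<open>g w * (w - x) ^ n\<close> preserves the exponent.\<close>

lemma zorder_cnj_cnj_of_real:
  assumes hol: "E holomorphic_on UNIV" and nz: "\<exists>w. E w \<noteq> 0"
  shows "zorder (\<lambda>z. cnj (E (cnj z))) (of_real x) = zorder E (of_real x)"
proof -
  define n where "n = zorder E (of_real x)"
  define g where "g = zor_poly E (of_real x)"
  have *: "(if E (of_real x) = 0 then n > 0 else n = 0) \<and> (\<exists>r. r > 0 \<and> cball (complex_of_real x) r \<subseteq> UNIV \<and> g holomorphic_on cball (of_real x) r
    \<and> (\<forall>w\<in>cball (of_real x) r. E w = g w * (w - of_real x) ^ nat n \<and> g w \<noteq> 0))"
    unfolding n_def g_def by (rule zorder_exist_zero) (use hol nz in auto)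
  then obtain r where r: "r > 0" "g holomorphic_on cball (of_real x) r"
    and gE: "\<And>w. w \<in> cball (of_real x) r \<Longrightarrow> E w = g w * (w - of_real x) ^ nat n \<and> g w \<noteq> 0" by blast
  have n0: "n \<ge> 0" using * by (auto split: if_splits)
  have cb: "cnj w \<in> ball (of_real x) r" if "w \<in> ball (of_real x) r" for w
  proof -
    have "cmod (of_real x - cnj w) = cmod (cnj (of_real x - w))" by simp
    also have "\<dots> = cmod (of_real x - w)" by (rule complex_mod_cnj)
    finally show ?thesis using that by (simp add: dist_norm)
  qed
  show ?thesis unfolding n_def[symmetric]
  proof (rule zorder_eqI[where S = "ball (of_real x) r" and g = "\<lambda>w. cnj (g (cnj w))"])
    have "cnj \<circ> g \<circ> cnj holomorphic_on ball (of_real x) r"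
      by (rule holomorphic_on_compose_cnj_cnj) (use cb in \<open>auto intro!: holomorphic_on_subset[OF r(2)] simp: less_imp_le\<close>)
    thus "(\<lambda>w. cnj (g (cnj w))) holomorphic_on ball (of_real x) r" by (simp add: o_def)
    show "cnj (E (cnj w)) = cnj (g (cnj w)) * (w - of_real x) powi n"
      if "w \<in> ball (of_real x) r" "w \<noteq> of_real x" for w
    proof -
      have "E (cnj w) = g (cnj w) * (cnj w - of_real x) ^ nat n"
        using gE[of "cnj w"] cb[OF that(1)] by (auto simp: less_imp_le)
      thus ?thesis using n0 by (simp add: power_int_def)
    qed
  qed (use r gE[of "of_real x"] in auto)
qed

lemma real_zeros_exp_cnj:
  assumes hol: "E holomorphic_on UNIV" and zeros: "\<And>z. E z = 0 \<Longrightarrow> z \<in> \<real>"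
  obtains u where "u holomorphic_on UNIV" "\<And>z. E z = exp (u z) * cnj (E (cnj z))"
proof -
  define F where "F z = cnj (E (cnj z))" for z
  have holF: "F holomorphic_on UNIV" unfolding F_def by (rule holomorphic_cnj_cnj_UNIV[OF hol])
  have nz: "E \<i> \<noteq> 0" using zeros[of \<i>] by (auto simp: complex_is_Real_iff)
  have zF: "F z = 0 \<longleftrightarrow> E z = 0" for z
  proof -
    have "E (cnj z) = 0 \<longleftrightarrow> E z = 0" using zeros[of z] zeros[of "cnj z"] Reals_cnj_iff[of z] Reals_cnj_iff[of "cnj z"]
      by (metis complex_cnj_cnj)
    thus ?thesis by (simp add: F_def)
  qed
  have "zorder F z = zorder E z" for z
  proof (cases "E z = 0")
    case True
    then obtain x where "z = of_real x" using zeros Reals_cases by metis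
    thus ?thesis unfolding F_def using zorder_cnj_cnj_of_real[OF hol] nz by blast
  next
    case False
    have "zorder E z = 0" "zorder F z = 0"
      using False zF[of z] hol holF by (auto intro!: zorder_eq_0I holomorphic_on_imp_analytic_at)
    thus ?thesis by simp
  qed
  then obtain h where h: "h holomorphic_on UNIV" "\<And>z. h z \<noteq> 0" "\<And>z. E z = h z * F z"
    using holomorphic_zorder_factorization[OF hol open_UNIV connected_UNIV holF] zF by auto
  obtain u where u: "u holomorphic_on UNIV" "\<And>z. z \<in> UNIV \<Longrightarrow> exp (u z) = h z"
  proof (rule holomorphic_logarithm_exists[of UNIV h 0])
    show "h x \<noteq> 0" for x by (rule h(2))
  qed (use h(1) in simp_all)
  show ?thesis
  proof (rule that[of u])
    show "E z = exp (u z) * cnj (E (cnj z))" for z using u(2)[of z] h(3)[of z] by (simp add: F_def)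
  qed (rule u(1))
qed

text \<open>At a real zero of \<open>E\<close> the equation says nothing about \<open>u\<close>.
  Hence \<open>exp (u z)\<close> times its reflection is shown to be 1 in the upper half-plane,
  where \<open>E\<close> has no zeros, and the identity is continued to the line.\<close>

lemma exp_cnj_Re_zero:
  assumes hol: "E holomorphic_on UNIV" and zeros: "\<And>z. E z = 0 \<Longrightarrow> z \<in> \<real>"
    and u: "u holomorphic_on UNIV" "\<And>z. E z = exp (u z) * cnj (E (cnj z))"
  shows "Re (u (of_real x)) = 0"
proof -
  define \<Phi> where "\<Phi> z = exp (u z) * exp (cnj (u (cnj z))) - 1" for z
  have "\<Phi> (of_real x) = 0"
  proof (rule analytic_continuation[where f = \<Phi> and S = UNIV and U = "{z. Im z > 0}" and \<xi> = \<i>])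
    show "\<Phi> holomorphic_on UNIV" unfolding \<Phi>_def
      by (intro holomorphic_intros u holomorphic_cnj_cnj_UNIV)
    show "\<i> islimpt {z. Im z > 0}"
      by (intro interior_limit_point) (simp add: interior_open open_halfspace_Im_gt)
    show "\<Phi> z = 0" if "z \<in> {z. Im z > 0}" for z
    proof -
      have nz: "E z \<noteq> 0" using that zeros[of z] by (auto simp: complex_is_Real_iff)
      have "E (cnj z) = exp (u (cnj z)) * cnj (E z)" using u(2)[of "cnj z"] by simp
      hence "cnj (E (cnj z)) = exp (cnj (u (cnj z))) * E z" by (simp add: exp_cnj)
      hence "exp (u z) * exp (cnj (u (cnj z))) * E z = E z" using u(2)[of z] by (simp add: mult.assoc)
      thus ?thesis using nz by (simp add: \<Phi>_def)
    qed
  qed auto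
  hence "exp (u (of_real x) + cnj (u (of_real x))) = 1" by (simp add: \<Phi>_def exp_add)
  hence "exp (of_real (2 * Re (u (of_real x)))) = (1::complex)" by (simp add: complex_add_cnj)
  hence "cmod (exp (of_real (2 * Re (u (of_real x))))) = 1" by simp
  thus ?thesis by simp
qed

lemma exp_cnj_quotient_affine:
  assumes holP: "P holomorphic_on UNIV" and holQ: "Q holomorphic_on UNIV"
    and zP: "\<And>z. P z = 0 \<Longrightarrow> z \<in> \<real>" and zQ: "\<And>z. Q z = 0 \<Longrightarrow> z \<in> \<real>"
    and zPQ: "\<And>z. P z = Q z \<Longrightarrow> z \<in> \<real>"
    and u: "u holomorphic_on UNIV" "\<And>z. P z = exp (u z) * cnj (P (cnj z))"
    and v: "v holomorphic_on UNIV" "\<And>z. Q z = exp (v z) * cnj (Q (cnj z))"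
  obtains c d :: real where "\<And>z. u z - v z = \<i> * (of_real c * z - of_real d)"
proof -
  have im: "z \<notin> \<real>" "cnj z \<notin> \<real>" if "Im z > 0" for z using that by (auto simp: complex_is_Real_iff)
  have log: "\<exists>L. L holomorphic_on {z. Im z > 0} \<and> (\<forall>z. Im z > 0 \<longrightarrow> exp (L z) = p z / q z)"
    if "p holomorphic_on UNIV" "q holomorphic_on UNIV" "\<And>z. Im z > 0 \<Longrightarrow> p z \<noteq> 0" "\<And>z. Im z > 0 \<Longrightarrow> q z \<noteq> 0" for p q
  proof -
    have "p holomorphic_on {z. Im z > 0}" "q holomorphic_on {z. Im z > 0}"
      using that(1,2) by (auto intro: holomorphic_on_subset)
    hence "(\<lambda>z. p z / q z) holomorphic_on {z. Im z > 0}" using that(4) by (intro holomorphic_on_divide) auto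
    hence "\<exists>L. L holomorphic_on {z. Im z > 0} \<and> (\<forall>z\<in>{z. Im z > 0}. exp (L z) = p z / q z)"
    proof (rule holomorphic_logarithm_exists[of "{z. Im z > 0}" "\<lambda>z. p z / q z" \<i>, rotated 2])
      show "p z / q z \<noteq> 0" if "z \<in> {z. Im z > 0}" for z
        using that \<open>\<And>z. Im z > 0 \<Longrightarrow> p z \<noteq> 0\<close> \<open>\<And>z. Im z > 0 \<Longrightarrow> q z \<noteq> 0\<close> by simp
    qed (auto simp: convex_halfspace_Im_gt open_halfspace_Im_gt)
    thus ?thesis by auto
  qed
  have nz: "P z \<noteq> 0" "Q z \<noteq> 0" "cnj (P (cnj z)) \<noteq> 0" "cnj (Q (cnj z)) \<noteq> 0" if "Im z > 0" for z
    using zP[of z] zQ[of z] zP[of "cnj z"] zQ[of "cnj z"] im[OF that] by auto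
  obtain L1 where L1: "L1 holomorphic_on {z. Im z > 0}" "\<And>z. Im z > 0 \<Longrightarrow> exp (L1 z) = P z / Q z"
    using log[OF holP holQ nz(1,2)] by auto
  obtain L2 where L2: "L2 holomorphic_on {z. Im z > 0}"
    "\<And>z. Im z > 0 \<Longrightarrow> exp (L2 z) = cnj (P (cnj z)) / cnj (Q (cnj z))"
    using log[OF holomorphic_cnj_cnj_UNIV[OF holP] holomorphic_cnj_cnj_UNIV[OF holQ] nz(3,4)] by auto
  have ne1: "exp (L1 w) \<noteq> 1" if "Im w > 0" for w
    using L1(2)[OF that] zPQ[of w] zQ[of w] im[OF that] by (auto simp: field_simps)
  have ne2: "exp (L2 w) \<noteq> 1" if "Im w > 0" for w
  proof
    assume "exp (L2 w) = 1"
    hence "cnj (P (cnj w)) = cnj (Q (cnj w))"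
      using L2(2)[OF that] zQ[of "cnj w"] im[OF that] by (auto simp: field_simps)
    thus False using zPQ[of "cnj w"] im[OF that] by simp
  qed
  obtain A1 where A1: "\<And>z. Im z > 0 \<Longrightarrow> \<bar>Re (L1 z)\<bar> \<le> A1 * (1 + (cmod z)^2) / Im z"
    using halfplane_growth[OF L1(1) ne1] by blast
  obtain A2 where A2: "\<And>z. Im z > 0 \<Longrightarrow> \<bar>Re (L2 z)\<bar> \<le> A2 * (1 + (cmod z)^2) / Im z"
    using halfplane_growth[OF L2(1) ne2] by blast
  \<comment> \<open>\<open>u - v\<close> is imaginary on the real line, so the factor
    \<open>- \<i>\<close> makes \<open>b\<close> real there.\<close>
  define b where "b z = - \<i> * (u z - v z)" for z
  have Imb: "Im (b z) = - Re (u z - v z)" for z by (simp add: b_def)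
  have holb: "b holomorphic_on UNIV" unfolding b_def by (intro holomorphic_intros u v)
  have realb: "b (of_real x) \<in> \<real>" for x :: real
    using exp_cnj_Re_zero[OF holP zP u] exp_cnj_Re_zero[OF holQ zQ v] by (simp add: complex_is_Real_iff Imb)
  have growthb: "\<bar>Im (b z)\<bar> \<le> (A1 + A2) * (1 + (cmod z)^2) / Im z" if z: "Im z > 0" for z
  proof -
    \<comment> \<open>The branches of \<open>L1\<close> and \<open>L2\<close> are unrelated, so only
      moduli are compared.\<close>
    have "exp (L1 z) = exp (u z - v z) * exp (L2 z)"
      unfolding L1(2)[OF z] L2(2)[OF z] exp_diff u(2)[of z] v(2)[of z] by simp
    hence "cmod (exp (L1 z)) = cmod (exp ((u z - v z) + L2 z))" by (simp add: exp_add)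
    hence "Re (L1 z) = Re (u z - v z) + Re (L2 z)" by simp
    hence "\<bar>Im (b z)\<bar> \<le> \<bar>Re (L1 z)\<bar> + \<bar>Re (L2 z)\<bar>" by (simp add: Imb)
    also have "\<dots> \<le> A1 * (1 + (cmod z)^2) / Im z + A2 * (1 + (cmod z)^2) / Im z"
      by (intro add_mono A1 A2 z)
    finally show ?thesis by (simp add: distrib_right add_divide_distrib)
  qed
  obtain c d :: real where cd: "\<And>z. b z = of_real c * z + of_real d"
    using entire_affine_if_growth[OF holb realb growthb] by metis
  show ?thesis
  proof (rule that[of c "-d"])
    show "u z - v z = \<i> * (of_real c * z - of_real (- d))" for z
      using arg_cong[OF cd[of z], of "\<lambda>w. \<i> * w"] by (simp add: b_def)
  qed
qed

section \<open>The Riemann sphere in homogeneous coordinates\<close>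

text \<open>The circle is the preimage of the unit circle under the Moebius map with coefficients
  \<open>\<alpha>, \<beta>, \<gamma>, \<delta>\<close>; homogeneous coordinates \<open>g\<close>,
  \<open>h\<close> include infinity.\<close>

lemma riemann_circle_norm_eq:
  fixes \<alpha> \<beta> \<gamma> \<delta> :: complex
  assumes det: "\<alpha> * \<delta> - \<beta> * \<gamma> \<noteq> 0"
  obtains C where "riemann_circle C"
    and "\<And>g h. g \<noteq> 0 \<or> h \<noteq> 0 \<Longrightarrow> cmod (\<alpha> * g + \<beta> * h) = cmod (\<gamma> * g + \<delta> * h) \<Longrightarrow>
      (if h = 0 then None else Some (g / h)) \<in> C"
proof -
  define N where "N = (cmod \<alpha>)^2 - (cmod \<gamma>)^2"
  define m where "m = \<alpha> * cnj \<beta> - \<gamma> * cnj \<delta>"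
  have affine: "N * (cmod w)^2 + 2 * Re (m * w) + (cmod \<beta>)^2 - (cmod \<delta>)^2 = 0"
    if "h \<noteq> 0" "cmod (\<alpha> * g + \<beta> * h) = cmod (\<gamma> * g + \<delta> * h)" "w = g / h" for g h w
  proof -
    have "\<alpha> * g + \<beta> * h = (\<alpha> * w + \<beta>) * h" "\<gamma> * g + \<delta> * h = (\<gamma> * w + \<delta>) * h"
      using that by (auto simp: field_simps)
    hence "cmod (\<alpha> * w + \<beta>) = cmod (\<gamma> * w + \<delta>)" using that by (simp add: norm_mult)
    hence "(cmod (\<alpha> * w + \<beta>))^2 = (cmod (\<gamma> * w + \<delta>))^2" by simp
    thus ?thesis unfolding N_def m_def cmod_power2 by (simp add: algebra_simps power2_eq_square)
  qed
  \<comment> \<open>A discriminant identity: it forces \<open>m \<noteq> 0\<close> in the case of a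
    line and gives the positive radius in the case of a circle.\<close>
  have key: "(cmod m)^2 = N * ((cmod \<beta>)^2 - (cmod \<delta>)^2) + (cmod (\<alpha> * \<delta> - \<beta> * \<gamma>))^2"
    unfolding N_def m_def cmod_power2 by (simp add: algebra_simps power2_eq_square)
  have detpos: "cmod (\<alpha> * \<delta> - \<beta> * \<gamma>) > 0" using det by simp
  show ?thesis
  proof (cases "N = 0")
    case True
    have m0: "m \<noteq> 0" using key True det by auto
    \<comment> \<open>The line is \<open>Re (m * w) = k / 2\<close>; dividing
      \<open>k / 2 + \<i> * t\<close> by \<open>m\<close> gives its base point and
      direction.\<close>
    define k where "k = (cmod \<delta>)^2 - (cmod \<beta>)^2"
    define p where "p = of_real (k / 2) / m"
    define v where "v = \<i> / m"
    define C where "C = insert None (Some ` {p + of_real t * v | t. True})"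
    show ?thesis
    proof (rule that[of C])
      show "riemann_circle C" unfolding riemann_circle_def C_def using m0 by (intro disjI2 exI[of _ p] exI[of _ v]) (simp add: v_def)
      fix g h assume gh: "g \<noteq> 0 \<or> h \<noteq> 0" "cmod (\<alpha> * g + \<beta> * h) = cmod (\<gamma> * g + \<delta> * h)"
      show "(if h = 0 then None else Some (g / h)) \<in> C"
      proof (cases "h = 0")
        case False
        have "Re (m * (g / h)) = k / 2" using affine[OF False gh(2) refl] True by (simp add: k_def)
        hence "m * (g / h) = of_real (k / 2) + of_real (Im (m * (g / h))) * \<i>"
          by (metis complex_eq mult.commute)
        hence "g / h = p + of_real (Im (m * (g / h))) * v"
          using m0 unfolding p_def v_def by (metis (no_types, lifting) add_divide_distrib nonzero_mult_div_cancel_left times_divide_eq_right)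
        thus ?thesis using False by (auto simp: C_def)
      qed (simp add: C_def)
    qed
  next
    case False
    define C where "C = Some ` sphere (- cnj m / of_real N) (cmod (\<alpha> * \<delta> - \<beta> * \<gamma>) / \<bar>N\<bar>)"
    show ?thesis
    proof (rule that[of C])
      show "riemann_circle C" unfolding riemann_circle_def C_def using detpos False by (auto intro!: exI)
      fix g h assume gh: "g \<noteq> 0 \<or> h \<noteq> 0" "cmod (\<alpha> * g + \<beta> * h) = cmod (\<gamma> * g + \<delta> * h)"
      have h: "h \<noteq> 0"
      proof
        assume "h = 0"
        hence "cmod \<alpha> = cmod \<gamma>" using gh by (simp add: norm_mult)
        thus False using False by (simp add: N_def)
      qed
      define w where "w = g / h"
      have "(cmod (of_real N * w + cnj m))^2 = N * (N * (cmod w)^2 + 2 * Re (m * w)) + (cmod m)^2"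
        unfolding cmod_power2 by (simp add: algebra_simps power2_eq_square)
      also have "N * (cmod w)^2 + 2 * Re (m * w) = (cmod \<delta>)^2 - (cmod \<beta>)^2"
        using affine[OF h gh(2) w_def] by simp
      finally have "(cmod (of_real N * w + cnj m))^2 = (cmod (\<alpha> * \<delta> - \<beta> * \<gamma>))^2"
        using key by (simp add: algebra_simps)
      hence "cmod (of_real N * w + cnj m) = cmod (\<alpha> * \<delta> - \<beta> * \<gamma>)" by simp
      moreover have "of_real N * w + cnj m = of_real N * (w - (- cnj m / of_real N))"
        using False by (simp add: field_simps)
      ultimately have "\<bar>N\<bar> * cmod (w - (- cnj m / of_real N)) = cmod (\<alpha> * \<delta> - \<beta> * \<gamma>)"
        by (metis norm_mult norm_of_real)
      hence "dist (- cnj m / of_real N) w = cmod (\<alpha> * \<delta> - \<beta> * \<gamma>) / \<bar>N\<bar>"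
        unfolding dist_norm norm_minus_commute[of _ w] using False by (simp only: eq_divide_eq mult.commute) simp
      hence "w \<in> sphere (- cnj m / of_real N) (cmod (\<alpha> * \<delta> - \<beta> * \<gamma>) / \<bar>N\<bar>)" by simp
      thus "(if h = 0 then None else Some (g / h)) \<in> C" using h by (auto simp: C_def w_def)
    qed
  qed
qed

text \<open>In the Weierstrass factorization of \<open>remove_sings f\<close> the numerator vanishes
  only at zeros and the denominator only at poles, which excludes common zeros.\<close>

lemma meromorphic_sphere_val_quotient:
  assumes "f meromorphic_on UNIV"
  obtains g h where "g holomorphic_on UNIV" "h holomorphic_on UNIV" "\<And>z. g z \<noteq> 0 \<or> h z \<noteq> 0"
    "\<And>z. sphere_val f z = (if h z = 0 then None else Some (g z / h z))"
proof -
  have pole: "is_pole (remove_sings f) z \<longleftrightarrow> is_pole f z" for z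
  proof -
    have "isolated_singularity_at f z" 
      by (rule meromorphic_on_isolated_singularity[OF meromorphic_on_subset[OF assms]]) simp
    thus ?thesis by simp
  qed
  obtain k f1 f2 where k: "k holomorphic_on UNIV" "f1 holomorphic_on UNIV" "f2 holomorphic_on UNIV"
    and z1: "\<forall>z. f1 z = 0 \<longleftrightarrow> \<not> is_pole (remove_sings f) z \<and> remove_sings f z = 0"
    and z2: "\<forall>z. f2 z = 0 \<longleftrightarrow> is_pole (remove_sings f) z"
    and kz: "\<forall>z. k z \<noteq> 0" and eq: "\<forall>z. remove_sings f z = k z * f1 z / f2 z"
    using weierstrass_factorization_meromorphic_UNIV[OF remove_sings_nicely_meromorphic[OF assms]] by metis
  show ?thesis
  proof (rule that[of "\<lambda>z. k z * f1 z" f2])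
    show "(\<lambda>z. k z * f1 z) holomorphic_on UNIV" by (intro holomorphic_intros k)
    show "k z * f1 z \<noteq> 0 \<or> f2 z \<noteq> 0" for z using z1 z2 kz by simp
    show "sphere_val f z = (if f2 z = 0 then None else Some (k z * f1 z / f2 z))" for z
      using z2 eq by (simp add: sphere_val_def pole)
  qed (rule k)
qed

text \<open>With infinity as \<open>(1, 0)\<close>, the equation \<open>f = a\<close> becomes linear
  in numerator and denominator for every point \<open>a\<close> of the sphere.\<close>

definition hom_num :: "complex option \<Rightarrow> complex" where
  "hom_num a = (case a of None \<Rightarrow> 1 | Some u \<Rightarrow> u)"

definition hom_den :: "complex option \<Rightarrow> complex" where
  "hom_den a = (case a of None \<Rightarrow> 0 | Some u \<Rightarrow> 1)"

lemma hom_det_nonzero: "a \<noteq> b \<Longrightarrow> hom_num a * hom_den b - hom_num b * hom_den a \<noteq> 0"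
  by (auto simp: hom_num_def hom_den_def split: option.splits)

lemma quotient_eq_iff_hom:
  assumes "g \<noteq> 0 \<or> h \<noteq> 0"
  shows "(if h = 0 then None else Some (g / h)) = a \<longleftrightarrow> hom_den a * g - hom_num a * h = 0"
  using assms by (auto simp: hom_num_def hom_den_def field_simps split: option.splits)

section \<open>Elimination of the reflections and the two alternatives\<close>

theorem theorem1:
  fixes f :: "complex \<Rightarrow> complex" and a1 a2 a3 :: "complex option"
  assumes mero: "f meromorphic_on UNIV"
    and distinct: "a1 \<noteq> a2" "a1 \<noteq> a3" "a2 \<noteq> a3"
    and real_sols: "\<And>z. sphere_val f z \<in> {a1, a2, a3} \<Longrightarrow> z \<in> \<real>"
  shows "(\<exists>C. riemann_circle C \<and> (\<forall>x::real. sphere_val f (of_real x) \<in> C)) \<or>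
         (\<exists>p q r s (c1::real) (c2::real) (b1::real) (b2::real).
            p * s - q * r \<noteq> 0 \<and>
            (\<exists>z. 1 - exp (\<i> * (of_real c2 * z - of_real b2)) \<noteq> 0) \<and>
            (\<forall>z. 1 - exp (\<i> * (of_real c2 * z - of_real b2)) \<noteq> 0 \<longrightarrow>
                 sphere_val f z = moebius p q r s
                   (Some ((1 - exp (\<i> * (of_real c1 * z - of_real b1))) /
                          (1 - exp (\<i> * (of_real c2 * z - of_real b2)))))))"
proof -
  obtain g h where gh: "g holomorphic_on UNIV" "h holomorphic_on UNIV" "\<And>z. g z \<noteq> 0 \<or> h z \<noteq> 0"
    and val: "\<And>z. sphere_val f z = (if h z = 0 then None else Some (g z / h z))"
    using meromorphic_sphere_val_quotient[OF mero] by metis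
  \<comment> \<open>Minors of the coordinate vectors \<open>v1, v2, v3\<close> of the three points.
    The relation \<open>D23 * v1 + D31 * v2 + D12 * v3 = 0\<close> dictates the scaling that makes
    \<open>E1 - E3\<close> a multiple of the form for \<open>a2\<close>.\<close>
  define D12 D23 D31 where "D12 = hom_num a1 * hom_den a2 - hom_num a2 * hom_den a1"
    and "D23 = hom_num a2 * hom_den a3 - hom_num a3 * hom_den a2"
    and "D31 = hom_num a3 * hom_den a1 - hom_num a1 * hom_den a3"
  have D: "D12 \<noteq> 0" "D23 \<noteq> 0" "D31 \<noteq> 0"
    using distinct hom_det_nonzero[of a1 a2] hom_det_nonzero[of a2 a3] hom_det_nonzero[of a3 a1]
    by (auto simp: D12_def D23_def D31_def)
  define A B C D where "A = D23 * hom_den a1" and "B = - D23 * hom_num a1"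
    and "C = - D12 * hom_den a3" and "D = D12 * hom_num a3"
  have "A * D - B * C = D23 * D12 * D31"
    by (simp add: A_def B_def C_def D_def D31_def algebra_simps)
  hence det: "A * D - B * C \<noteq> 0" using D by simp
  define E1 E3 E2 where "E1 z = A * g z + B * h z" and "E3 z = C * g z + D * h z"
    and "E2 z = E1 z - E3 z" for z
  have E2: "E2 z = - D31 * (hom_den a2 * g z - hom_num a2 * h z)" for z
    unfolding E2_def E1_def E3_def A_def B_def C_def D_def D12_def D23_def D31_def by algebra
  have holE: "E1 holomorphic_on UNIV" "E2 holomorphic_on UNIV" "E3 holomorphic_on UNIV"
    unfolding E2_def E1_def E3_def by (intro holomorphic_intros gh)+
  have zeros: "E1 z = 0 \<Longrightarrow> z \<in> \<real>" "E2 z = 0 \<Longrightarrow> z \<in> \<real>" "E3 z = 0 \<Longrightarrow> z \<in> \<real>" for z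
  proof -
    have "sphere_val f z = a1" if "E1 z = 0"
    proof -
      have "D23 * (hom_den a1 * g z - hom_num a1 * h z) = 0"
        using that by (simp add: E1_def A_def B_def algebra_simps)
      thus ?thesis using D gh(3)[of z] by (simp add: val quotient_eq_iff_hom)
    qed
    moreover have "sphere_val f z = a3" if "E3 z = 0"
    proof -
      have "D12 * (hom_den a3 * g z - hom_num a3 * h z) = - E3 z"
        by (simp add: E3_def C_def D_def algebra_simps)
      hence "D12 * (hom_den a3 * g z - hom_num a3 * h z) = 0" using that by simp
      thus ?thesis using D gh(3)[of z] by (simp add: val quotient_eq_iff_hom)
    qed
    moreover have "sphere_val f z = a2" if "E2 z = 0"
      using that D gh(3)[of z] by (simp add: E2 val quotient_eq_iff_hom)
    ultimately show "E1 z = 0 \<Longrightarrow> z \<in> \<real>" "E2 z = 0 \<Longrightarrow> z \<in> \<real>" "E3 z = 0 \<Longrightarrow> z \<in> \<real>"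
      using real_sols by blast+
  qed
  obtain u1 where u1: "u1 holomorphic_on UNIV" "\<And>z. E1 z = exp (u1 z) * cnj (E1 (cnj z))"
    using real_zeros_exp_cnj[OF holE(1) zeros(1)] by blast
  obtain u2 where u2: "u2 holomorphic_on UNIV" "\<And>z. E2 z = exp (u2 z) * cnj (E2 (cnj z))"
    using real_zeros_exp_cnj[OF holE(2) zeros(2)] by blast
  obtain u3 where u3: "u3 holomorphic_on UNIV" "\<And>z. E3 z = exp (u3 z) * cnj (E3 (cnj z))"
    using real_zeros_exp_cnj[OF holE(3) zeros(3)] by blast
  \<comment> \<open>\<open>E2 = E1\<close> means \<open>E3 = 0\<close>: the third value makes
    \<open>E2 / E1\<close> omit 1 off the real line.\<close>
  have zeros21: "E2 z = E1 z \<Longrightarrow> z \<in> \<real>" for z using zeros(3)[of z] by (simp add: E2_def)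
  obtain c2 b2 :: real where c2: "\<And>z. u2 z - u1 z = \<i> * (of_real c2 * z - of_real b2)"
    using exp_cnj_quotient_affine[OF holE(2,1) zeros(2,1) zeros21 u2 u1] by metis
  \<comment> \<open>\<open>E2 / E3\<close> omits -1 instead of 1; passing to \<open>- E2\<close>
    corrects this and keeps the exponent \<open>u2\<close>.\<close>
  have u2': "- E2 z = exp (u2 z) * cnj (- E2 (cnj z))" for z
    using arg_cong[OF u2(2)[of z], of uminus] by simp
  have hol2': "(\<lambda>z. - E2 z) holomorphic_on UNIV" by (intro holomorphic_intros holE)
  have zeros2': "- E2 z = 0 \<Longrightarrow> z \<in> \<real>" for z using zeros(2) by simp
  have zeros23: "- E2 z = E3 z \<Longrightarrow> z \<in> \<real>" for z using zeros(1)[of z] by (simp add: E2_def)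
  obtain c1 b1 :: real where c1: "\<And>z. u2 z - u3 z = \<i> * (of_real c1 * z - of_real b1)"
    using exp_cnj_quotient_affine[OF hol2' holE(3) zeros2' zeros(3) zeros23 u2(1) u2' u3] by metis
  \<comment> \<open>Reflecting \<open>E2 = E1 - E3\<close> and multiplying by
    \<open>exp (u2 z)\<close> gives a second expression of \<open>E2\<close> through
    \<open>E1\<close> and \<open>E3\<close>, to be equated with the first.\<close>
  have rel: "E1 z * (1 - exp (u2 z - u1 z)) = E3 z * (1 - exp (u2 z - u3 z))" for z
  proof -
    have "E1 z * exp (u2 z - u1 z) = exp (u2 z) * cnj (E1 (cnj z))"
      "E3 z * exp (u2 z - u3 z) = exp (u2 z) * cnj (E3 (cnj z))"
      unfolding exp_diff using u1(2)[of z] u3(2)[of z] by (auto simp: field_simps)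
    moreover have "E1 z - E3 z = exp (u2 z) * cnj (E1 (cnj z)) - exp (u2 z) * cnj (E3 (cnj z))"
      using u2(2)[of z] by (simp add: E2_def algebra_simps)
    ultimately show ?thesis by (simp add: algebra_simps)
  qed
  have num: "(A * D - B * C) * g z = D * E1 z - B * E3 z"
    and den: "(A * D - B * C) * h z = - C * E1 z + A * E3 z" for z
    unfolding E1_def E3_def by algebra+
  have nocommon: "E1 z \<noteq> 0 \<or> E3 z \<noteq> 0" for z
    using num[of z] den[of z] gh(3)[of z] det by auto
  show ?thesis
  proof (cases "\<exists>z. 1 - exp (u2 z - u1 z) \<noteq> 0")
    case True
    \<comment> \<open>\<open>D, - B, - C, A\<close> is the adjugate of the matrix taking
      \<open>(g, h)\<close> to \<open>(E1, E3)\<close>, so this map recovers \<open>g / h\<close>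
      from \<open>E1 / E3\<close>.\<close>
    have mob: "sphere_val f z = moebius D (- B) (- C) A
        (Some ((1 - exp (u2 z - u3 z)) / (1 - exp (u2 z - u1 z))))"
      if nz: "1 - exp (u2 z - u1 z) \<noteq> 0" for z
    proof -
      have E3: "E3 z \<noteq> 0" using rel[of z] nocommon[of z] nz by auto
      have w: "(1 - exp (u2 z - u3 z)) / (1 - exp (u2 z - u1 z)) = E1 z / E3 z"
        using rel[of z] E3 nz by (simp add: field_simps)
      have "D * (E1 z / E3 z) + - B = (A * D - B * C) * g z / E3 z"
        "- C * (E1 z / E3 z) + A = (A * D - B * C) * h z / E3 z"
        unfolding num den using E3 by (auto simp: field_simps)
      thus ?thesis unfolding w moebius_def val using det E3 by simp
    qed
    show ?thesis
    proof (rule disjI2, rule exI[of _ D], rule exI[of _ "- B"], rule exI[of _ "- C"], rule exI[of _ A],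
        rule exI[of _ c1], rule exI[of _ c2], rule exI[of _ b1], rule exI[of _ b2], intro conjI)
      show "D * A - - B * - C \<noteq> 0" using det by (simp add: mult.commute[of D A])
    next
      show "\<exists>z. 1 - exp (\<i> * (of_real c2 * z - of_real b2)) \<noteq> 0"
        using True unfolding c2 .
    next
      show "\<forall>z. 1 - exp (\<i> * (of_real c2 * z - of_real b2)) \<noteq> 0 \<longrightarrow>
          sphere_val f z = moebius D (- B) (- C) A
            (Some ((1 - exp (\<i> * (of_real c1 * z - of_real b1))) /
                   (1 - exp (\<i> * (of_real c2 * z - of_real b2)))))"
        using mob unfolding c1 c2 by blast
    qed
  next
    case False
    \<comment> \<open>The coefficients of \<open>E1 - \<i> * E3\<close> and
      \<open>E1 + \<i> * E3\<close>, whose moduli agree when \<open>E1 / E3\<close> is real or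
      infinite.\<close>
    have det': "(A - \<i> * C) * (B + \<i> * D) - (B - \<i> * D) * (A + \<i> * C) \<noteq> 0"
    proof -
      have "(A - \<i> * C) * (B + \<i> * D) - (B - \<i> * D) * (A + \<i> * C) = 2 * \<i> * (A * D - B * C)"
        by algebra
      thus ?thesis using det by simp
    qed
    obtain S where S: "riemann_circle S"
      "\<And>g h. g \<noteq> 0 \<or> h \<noteq> 0 \<Longrightarrow> cmod ((A - \<i> * C) * g + (B - \<i> * D) * h) = cmod ((A + \<i> * C) * g + (B + \<i> * D) * h) \<Longrightarrow>
        (if h = 0 then None else Some (g / h)) \<in> S"
      using riemann_circle_norm_eq[OF det'] by metis
    have "sphere_val f (of_real x) \<in> S" for x :: real
    proof -
      define z where "z = complex_of_real x"
      have cz: "cnj z = z" by (simp add: z_def)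
      have e1: "exp (u1 z) = exp (u2 z)" using False by (simp add: exp_diff)
      have im: "Im (E1 z * cnj (E3 z)) = 0"
      proof (cases "E3 z = 0")
        case False
        \<comment> \<open>All three exponentials now agree at \<open>z\<close>, so conjugation
          changes \<open>E1 z\<close> and \<open>E3 z\<close> by the same factor.\<close>
        have "exp (u3 z) = exp (u2 z)" using rel[of z] e1 False by (simp add: exp_diff)
        hence "E1 z * cnj (E3 z) = cnj (E1 z) * E3 z"
          using u1(2)[of z] u3(2)[of z] unfolding cz e1 by (metis mult.assoc mult.commute)
        thus ?thesis
          by (metis complex_cnj_cnj complex_cnj_mult Reals_cnj_iff complex_is_Real_iff)
      qed simp
      have "(cmod (E1 z - \<i> * E3 z))^2 = (cmod (E1 z + \<i> * E3 z))^2"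
        using im unfolding cmod_power2 by (simp add: algebra_simps power2_eq_square)
      hence "cmod (E1 z - \<i> * E3 z) = cmod (E1 z + \<i> * E3 z)" by simp
      moreover have "E1 z - \<i> * E3 z = (A - \<i> * C) * g z + (B - \<i> * D) * h z"
        "E1 z + \<i> * E3 z = (A + \<i> * C) * g z + (B + \<i> * D) * h z"
        unfolding E1_def E3_def by algebra+
      ultimately show ?thesis unfolding val z_def[symmetric] using S(2)[OF gh(3)] by simp
    qed
    thus ?thesis using S(1) by blast
  qed
qed

end
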